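(* Let $q\in(0,1)$, $\omega\ge0$, let $I$ be a real interval containing $\omega_0=\frac{\omega}{1-q}$, and suppose $a,b\in I$, $a<b$, and $a,b\in[c]_{q,\omega}$ for some $c\in I$. Let $\alpha,\beta\in\mathbb R$ and let $L(t,u,v)$ be a real function on $I\times\mathbb R^2$. Consider the problem of extremizing $$\mathcal L[y]=\int_a^bL\left(t,y^\sigma(t),\tilde D_{q,\omega}[y](t)\right)\tilde d_{q,\omega}t$$ over all $y\in\mathcal Y^1([a,b]_{q,\omega},\mathbb R)$ with $y(a)=\alpha$ and $y(b)=\beta$ (such $y$ are called admissible), where $L$ satisfies: (i) $(u,v)\mapsto L(t,u,v)$ is a $C^1(\mathbb R^2,\mathbb R)$ function for every $t\in I$; (ii) $t\mapsto L(t,y^\sigma(t),\tilde D_{q,\omega}[y](t))$ is continuous at $\omega_0$ for every admissible $y$; (iii) for every admissible $y$ and $i=0,1$, the function $t\mapsto\partial_{i+2}L(t,y^\sigma(t),\tilde D_{q,\omega}[y](t))$ belongs to $\mathcal Y^1([a,b]_{q,\omega},\mathbb R)$. Assume that $L$ is jointly convex (resp. jointly concave) in $(u,v)$. If an admissible function $y_*$ satisfies (with $y=y_*$) the Hahn symmetric Euler–Lagrange equation $$\partial_2L\left(t,y^\sigma(t),\tilde D_{q,\omega}[y](t)\right)=\tilde D_{q,\omega}\left[\tau\mapsto\partial_3L\left(\sigma(\tau),y^{\sigma^2}(\tau),(\tilde D_{q,\omega}[y])^\sigma(\tau)\right)\right](t)\quad\text{for all }t\in[a,b]_{q,\omega},$$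 then $y_*$ is a global minimizer (resp. global maximizer) of the problem, i.e. $\mathcal L[y_*]\le\mathcal L[y]$ (resp. $\ge$) for all admissible $y$.
   Context: Notation: $\sigma(t)=qt+\omega$, $\sigma^{-1}(t)=q^{-1}(t-\omega)$, $\sigma^k$ the $k$-fold composition, $f^{\sigma^k}=f\circ\sigma^k$. $\partial_jL$ is the partial derivative of $L$ with respect to its $j$th argument. Hahn symmetric derivative: for $f:I\to\mathbb R$ and $t\in(qI+\omega)\setminus\{\omega_0\}$, $\tilde D_{q,\omega}[f](t)=\frac{f(qt+\omega)-f(q^{-1}(t-\omega))}{(q-q^{-1})t+(1+q^{-1})\omega}$, and $\tilde D_{q,\omega}[f](\omega_0)=f'(\omega_0)$ provided $f$ is differentiable at $\omega_0$. Integral: $\int_a^bf\,\tilde d_{q,\omega}t=\int_{\omega_0}^bf\,\tilde d_{q,\omega}t-\int_{\omega_0}^af\,\tilde d_{q,\omega}t$, where $\int_{\omega_0}^xf(t)\,\tilde d_{q,\omega}t=(\sigma^{-1}(x)-\sigma(x))\sum_{n=0}^{\infty}q^{2n+1}f(\sigma^{2n+1}(x))$, provided the series converge. Sets: $[s]_{q,\omega}=\{\sigma^{2n+1}(s):n\in\mathbb N_0\}\cup\{\omega_0\}$ and $[a,b]_{q,\omega}=[a]_{q,\omega}\cup[b]_{q,\omega}$. Space: $\mathcal Y^1([a,b]_{q,\omega},\mathbb R)$ is the set of $y:I\to\mathbb R$ such that $y$ and $\tilde D_{q,\omega}[y]$ are bounded on $[a,b]_{q,\omega}$ and continuous at $\omega_0$.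 $L$ is jointly convex (resp. jointly concave) in $(u,v)$ if $\partial_2L,\partial_3L$ exist and are continuous and $L(t,u+u_1,v+v_1)-L(t,u,v)\ge$ (resp. $\le$) $\partial_2L(t,u,v)u_1+\partial_3L(t,u,v)v_1$ for all $(t,u,v),(t,u+u_1,v+v_1)\in I\times\mathbb R^2$. *)

theory Defs
  imports "HOL-Analysis.Analysis"
begin

definition hahn_shift :: "real \<Rightarrow> real \<Rightarrow> real \<Rightarrow> real" where
  "hahn_shift q \<omega> t = q * t + \<omega>"

definition hahn_unshift :: "real \<Rightarrow> real \<Rightarrow> real \<Rightarrow> real" where
  "hahn_unshift q \<omega> t = inverse q * (t - \<omega>)"

text \<open>The common fixed point of the two maps above.\<close>

definition hahn_fixpoint :: "real \<Rightarrow> real \<Rightarrow> real" where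
  "hahn_fixpoint q \<omega> = \<omega> / (1 - q)"

definition hahn_orbit :: "real \<Rightarrow> real \<Rightarrow> real \<Rightarrow> real set" where
  "hahn_orbit q \<omega> s =
     range (\<lambda>n::nat. (hahn_shift q \<omega> ^^ (2 * n + 1)) s) \<union> {hahn_fixpoint q \<omega>}"

definition hahn_orbits :: "real \<Rightarrow> real \<Rightarrow> real \<Rightarrow> real \<Rightarrow> real set" where
  "hahn_orbits q \<omega> a b = hahn_orbit q \<omega> a \<union> hahn_orbit q \<omega> b"

text \<open>
  Functions on an interval \<open>I\<close> containing the fixed point are represented by total functions.
  The derivative below is meaningful at the fixed point when \<open>f\<close> is differentiable there relative
  to \<open>I\<close> (one-sidedly if the fixed point is an endpoint of \<open>I\<close>), and at other points \<open>t\<close> of the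
  image of \<open>I\<close> under the shift; there it depends only on the values of \<open>f\<close> on \<open>I\<close>.
\<close>

definition hahn_sym_deriv ::
  "real \<Rightarrow> real \<Rightarrow> real set \<Rightarrow> (real \<Rightarrow> real) \<Rightarrow> real \<Rightarrow> real" where
  "hahn_sym_deriv q \<omega> I f t =
     (if t = hahn_fixpoint q \<omega> then vector_derivative f (at t within I)
      else (f (hahn_shift q \<omega> t) - f (hahn_unshift q \<omega> t))
             / ((q - inverse q) * t + (1 + inverse q) * \<omega>))"

definition hahn_integral_from_fixpoint ::
  "real \<Rightarrow> real \<Rightarrow> real \<Rightarrow> (real \<Rightarrow> real) \<Rightarrow> real" where
  "hahn_integral_from_fixpoint q \<omega> x f =
     (hahn_unshift q \<omega> x - hahn_shift q \<omega> x)
       * (\<Sum>n. q ^ (2 * n + 1) * f ((hahn_shift q \<omega> ^^ (2 * n + 1)) x))"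

definition hahn_integral ::
  "real \<Rightarrow> real \<Rightarrow> real \<Rightarrow> real \<Rightarrow> (real \<Rightarrow> real) \<Rightarrow> real" where
  "hahn_integral q \<omega> a b f =
     hahn_integral_from_fixpoint q \<omega> b f - hahn_integral_from_fixpoint q \<omega> a f"

text \<open>
  That the symmetric derivative is defined at the fixed point, which lies in the orbits, is the
  differentiability conjunct.  Shrinking a nondegenerate interval \<open>I\<close> towards the fixed point by
  iterates of the shift yields the same filter \<open>at _ within I\<close>.  Hence the definition also applies
  to functions, such as symmetric derivatives of functions on \<open>I\<close>, that are meaningful only on
  the image of \<open>I\<close> under the shift.
\<close>

definition hahn_Y1 ::
  "real \<Rightarrow> real \<Rightarrow> real set \<Rightarrow> real \<Rightarrow> real \<Rightarrow> (real \<Rightarrow> real) set" where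
  "hahn_Y1 q \<omega> I a b =
     {y. y differentiable (at (hahn_fixpoint q \<omega>) within I)
       \<and> bounded (y ` hahn_orbits q \<omega> a b)
       \<and> bounded (hahn_sym_deriv q \<omega> I y ` hahn_orbits q \<omega> a b)
       \<and> continuous (at (hahn_fixpoint q \<omega>) within I) y
       \<and> continuous (at (hahn_fixpoint q \<omega>) within I) (hahn_sym_deriv q \<omega> I y)}"

definition hahn_admissible ::
  "real \<Rightarrow> real \<Rightarrow> real set \<Rightarrow> real \<Rightarrow> real \<Rightarrow> real \<Rightarrow> real \<Rightarrow> (real \<Rightarrow> real) set" where
  "hahn_admissible q \<omega> I a b \<alpha> \<beta> = {y \<in> hahn_Y1 q \<omega> I a b. y a = \<alpha> \<and> y b = \<beta>}"

definition partial2 :: "(real \<Rightarrow> real \<Rightarrow> real \<Rightarrow> real) \<Rightarrow> real \<Rightarrow> real \<Rightarrow> real \<Rightarrow> real" where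
  "partial2 L t u v = deriv (\<lambda>x. L t x v) u"

definition partial3 :: "(real \<Rightarrow> real \<Rightarrow> real \<Rightarrow> real) \<Rightarrow> real \<Rightarrow> real \<Rightarrow> real \<Rightarrow> real" where
  "partial3 L t u v = deriv (\<lambda>x. L t u x) v"

definition C1_plane :: "(real \<times> real \<Rightarrow> real) \<Rightarrow> bool" where
  "C1_plane f \<longleftrightarrow>
     (\<exists>f' :: real \<times> real \<Rightarrow> (real \<times> real) \<Rightarrow>\<^sub>L real.
        (\<forall>x. (f has_derivative blinfun_apply (f' x)) (at x)) \<and> continuous_on UNIV f')"

definition C1_partials23 :: "real set \<Rightarrow> (real \<Rightarrow> real \<Rightarrow> real \<Rightarrow> real) \<Rightarrow> bool" where
  "C1_partials23 I L \<longleftrightarrow>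
     (\<forall>t\<in>I. \<forall>u v. (\<lambda>x. L t x v) field_differentiable (at u)
                  \<and> (\<lambda>x. L t u x) field_differentiable (at v))
     \<and> continuous_on (I \<times> UNIV) (\<lambda>(t, u, v). partial2 L t u v)
     \<and> continuous_on (I \<times> UNIV) (\<lambda>(t, u, v). partial3 L t u v)"

definition jointly_convex :: "real set \<Rightarrow> (real \<Rightarrow> real \<Rightarrow> real \<Rightarrow> real) \<Rightarrow> bool" where
  "jointly_convex I L \<longleftrightarrow> C1_partials23 I L \<and>
     (\<forall>t\<in>I. \<forall>u v u1 v1.
        L t (u + u1) (v + v1) - L t u v \<ge> partial2 L t u v * u1 + partial3 L t u v * v1)"

definition jointly_concave :: "real set \<Rightarrow> (real \<Rightarrow> real \<Rightarrow> real \<Rightarrow> real) \<Rightarrow> bool" where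
  "jointly_concave I L \<longleftrightarrow> C1_partials23 I L \<and>
     (\<forall>t\<in>I. \<forall>u v u1 v1.
        L t (u + u1) (v + v1) - L t u v \<le> partial2 L t u v * u1 + partial3 L t u v * v1)"

text \<open>
  Composition of a function \<open>F\<close> of three variables (the Lagrangian or one of its partial
  derivatives) with the shifted function and the symmetric derivative of \<open>y\<close>.
\<close>

definition hahn_along ::
  "real \<Rightarrow> real \<Rightarrow> real set \<Rightarrow> (real \<Rightarrow> real \<Rightarrow> real \<Rightarrow> real) \<Rightarrow> (real \<Rightarrow> real) \<Rightarrow> real \<Rightarrow> real" where
  "hahn_along q \<omega> I F y t = F t (y (hahn_shift q \<omega> t)) (hahn_sym_deriv q \<omega> I y t)"

definition hahn_functional ::
  "real \<Rightarrow> real \<Rightarrow> real set \<Rightarrow> (real \<Rightarrow> real \<Rightarrow> real \<Rightarrow> real) \<Rightarrow> real \<Rightarrow> real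
     \<Rightarrow> (real \<Rightarrow> real) \<Rightarrow> real" where
  "hahn_functional q \<omega> I L a b y = hahn_integral q \<omega> a b (hahn_along q \<omega> I L y)"

definition hahn_euler_lagrange ::
  "real \<Rightarrow> real \<Rightarrow> real set \<Rightarrow> (real \<Rightarrow> real \<Rightarrow> real \<Rightarrow> real) \<Rightarrow> real \<Rightarrow> real
     \<Rightarrow> (real \<Rightarrow> real) \<Rightarrow> bool" where
  "hahn_euler_lagrange q \<omega> I L a b y \<longleftrightarrow>
     (\<forall>t\<in>hahn_orbits q \<omega> a b.
        partial2 L t (y (hahn_shift q \<omega> t)) (hahn_sym_deriv q \<omega> I y t) =
        hahn_sym_deriv q \<omega> I
          (\<lambda>\<tau>. partial3 L (hahn_shift q \<omega> \<tau>)
                 (y ((hahn_shift q \<omega> ^^ 2) \<tau>))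
                 (hahn_sym_deriv q \<omega> I y (hahn_shift q \<omega> \<tau>))) t)"

end

theory Submission
  imports Defs
begin

text \<open>
  Let \<open>s\<close> be the endpoint farther from the fixed point and \<open>t\<^sub>n\<close> the \<open>n\<close>-th iterate of \<open>s\<close> under the
  shift.  The functional is a sum over \<open>n\<close> of \<open>(t\<^sub>2\<^sub>n - t\<^sub>2\<^sub>n\<^sub>+\<^sub>2) L(t\<^sub>2\<^sub>n\<^sub>+\<^sub>1, \<dots>)\<close>, stopped at the other endpoint,
  with weights of constant sign.  Put \<open>\<eta> = y - y\<^sub>*\<close> and \<open>g = \<partial>\<^sub>3L\<close> along \<open>y\<^sub>*\<close>.  Convexity bounds the
  difference of two summands by the linearisation, which the Euler--Lagrange equation turns into the
  telescoping term \<open>g(t\<^sub>2\<^sub>n\<^sub>+\<^sub>1) \<eta>(t\<^sub>2\<^sub>n) - g(t\<^sub>2\<^sub>n\<^sub>+\<^sub>3) \<eta>(t\<^sub>2\<^sub>n\<^sub>+\<^sub>2)\<close>.  Its sum vanishes because \<open>\<eta>\<close> is zero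
  at both endpoints.
\<close>

section \<open>Iterates of the shift and the symmetric derivative along them\<close>

locale hahn_calculus =
  fixes q \<omega> :: real
  assumes q_pos: "0 < q" and q_less_1: "q < 1"
begin

abbreviation fixpt :: real where "fixpt \<equiv> hahn_fixpoint q \<omega>"

abbreviation iter :: "nat \<Rightarrow> real \<Rightarrow> real" where "iter n \<equiv> hahn_shift q \<omega> ^^ n"

text \<open>Centred at its fixed point, the shift is plain scaling by \<open>q\<close>, so its
  iterates have a closed form.\<close>

lemma shift_eq: "hahn_shift q \<omega> t = fixpt + q * (t - fixpt)"
proof -
  have "fixpt * (1 - q) = \<omega>"
    using q_less_1 by (simp add: hahn_fixpoint_def)
  then show ?thesis by (simp add: hahn_shift_def algebra_simps)
qed

lemma unshift_shift [simp]: "hahn_unshift q \<omega> (hahn_shift q \<omega> t) = t"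
  using q_pos by (simp add: hahn_shift_def hahn_unshift_def)

lemma iter_eq: "iter n s = fixpt + q ^ n * (s - fixpt)"
  by (induction n) (simp_all add: shift_eq)

lemma iter_fixpt [simp]: "iter n fixpt = fixpt"
  by (simp add: iter_eq)

lemma iter_eq_fixpt_iff: "iter n s = fixpt \<longleftrightarrow> s = fixpt"
  using q_pos by (simp add: iter_eq)

lemma iter_tendsto_fixpt: "(\<lambda>n. iter n s) \<longlonglongrightarrow> fixpt"
proof -
  have "(\<lambda>n. q ^ n) \<longlonglongrightarrow> 0"
    using q_pos q_less_1 by (intro LIMSEQ_realpow_zero) simp_all
  then have "(\<lambda>n. fixpt + q ^ n * (s - fixpt)) \<longlonglongrightarrow> fixpt + 0 * (s - fixpt)"
    by (intro tendsto_add tendsto_mult tendsto_const)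
  then show ?thesis by (simp add: iter_eq)
qed

text \<open>Each iterate is a convex combination of \<open>fixpt\<close> and
  \<open>s\<close>.\<close>

lemma iter_mem:
  assumes "is_interval I" "fixpt \<in> I" "s \<in> I"
  shows "iter n s \<in> I"
proof -
  have "(1 - q ^ n) *\<^sub>R fixpt + q ^ n *\<^sub>R s \<in> I"
    using assms q_pos q_less_1 is_interval_convex[of I] convexD_alt[of I fixpt s "q ^ n"]
    by (simp add: power_le_one)
  then show ?thesis by (simp add: iter_eq algebra_simps)
qed

text \<open>The index map \<open>r\<close> is left free to cover both the even and the odd
  iterates.\<close>

lemma continuous_along_iter:
  assumes "continuous (at fixpt within I) (f :: real \<Rightarrow> real)"
    and "is_interval I" "fixpt \<in> I" "s \<in> I" and "strict_mono r"
  shows "(\<lambda>n. f (iter (r n) s)) \<longlonglongrightarrow> f fixpt"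
  using continuous_within_tendsto_compose'[OF assms(1), of "\<lambda>n. iter (r n) s" sequentially]
    iter_mem[OF assms(2-4)] LIMSEQ_subseq_LIMSEQ[OF iter_tendsto_fixpt[of s] assms(5)]
  by (simp add: o_def)

text \<open>Away from the fixed point, the denominator in the definition is shift minus unshift of
  the point, and these are its two neighbours in the orbit. Derivatives thus become differences that
  can telescope.\<close>

lemma sym_deriv_iter:
  assumes "s \<noteq> fixpt"
  shows "hahn_sym_deriv q \<omega> I f (iter (Suc n) s) =
    (f (iter (Suc (Suc n)) s) - f (iter n s)) / (iter (Suc (Suc n)) s - iter n s)"
proof -
  let ?t = "iter (Suc n) s"
  have "(q - inverse q) * ?t + (1 + inverse q) * \<omega> = hahn_shift q \<omega> ?t - hahn_unshift q \<omega> ?t"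
    by (simp add: hahn_shift_def hahn_unshift_def algebra_simps)
  moreover have "?t \<noteq> fixpt"
    using assms iter_eq_fixpt_iff by blast
  ultimately show ?thesis
    by (simp add: hahn_sym_deriv_def)
qed

lemma sym_deriv_diff_iter:
  assumes "s \<noteq> fixpt"
  shows "hahn_sym_deriv q \<omega> I f (iter (Suc n) s) - hahn_sym_deriv q \<omega> I g (iter (Suc n) s) =
    ((f (iter (Suc (Suc n)) s) - g (iter (Suc (Suc n)) s)) - (f (iter n s) - g (iter n s)))
      / (iter (Suc (Suc n)) s - iter n s)"
  unfolding sym_deriv_iter[OF assms] by (simp add: diff_divide_distrib)

section \<open>The symmetric integral as a series over an orbit\<close>

text \<open>The prefactor of the integral is absorbed into each term: multiplied by
  \<open>q ^ (2 * n + 1)\<close>, it is the distance, with sign, between the two neighbours of the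
  sample point.\<close>

definition int_term :: "(real \<Rightarrow> real) \<Rightarrow> real \<Rightarrow> nat \<Rightarrow> real" where
  "int_term f s n = (iter (2 * n) s - iter (2 * n + 2) s) * f (iter (2 * n + 1) s)"

lemma int_term_fixpt [simp]: "int_term f fixpt = (\<lambda>n. 0)"
  unfolding int_term_def iter_fixpt by simp

lemma iter_weight_eq: "iter (2 * n) s - iter (2 * n + 2) s = (1 - q\<^sup>2) * q ^ (2 * n) * (s - fixpt)"
  unfolding iter_eq power_add by (simp add: algebra_simps)

text \<open>Continuity at the fixed point bounds \<open>f\<close> on the odd iterates, so a
  geometric series of ratio \<open>q\<^sup>2\<close> dominates.\<close>

lemma int_term_summable:
  assumes "continuous (at fixpt within I) f" "is_interval I" "fixpt \<in> I" "s \<in> I"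
  shows "summable (int_term f s)"
proof -
  have "strict_mono (\<lambda>n::nat. 2 * n + 1)"
    by (simp add: strict_mono_def)
  then have "(\<lambda>n. f (iter (2 * n + 1) s)) \<longlonglongrightarrow> f fixpt"
    using continuous_along_iter[OF assms] by blast
  then have "Bseq (\<lambda>n. f (iter (2 * n + 1) s))"
    using convergentI convergent_imp_Bseq by blast
  then obtain K where K: "\<And>n. \<bar>f (iter (2 * n + 1) s)\<bar> \<le> K"
    unfolding Bseq_def by auto
  have q2: "\<bar>q\<^sup>2\<bar> < 1"
    using q_pos q_less_1 by (simp add: power_less_one_iff abs_square_less_1)
  have "summable (\<lambda>n. \<bar>(1 - q\<^sup>2) * (s - fixpt)\<bar> * K * (q\<^sup>2) ^ n)"
    using q2 by (intro summable_mult summable_geometric) simp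
  moreover have "norm (int_term f s n) \<le> \<bar>(1 - q\<^sup>2) * (s - fixpt)\<bar> * K * (q\<^sup>2) ^ n" for n
  proof -
    have "norm (int_term f s n) =
        (\<bar>(1 - q\<^sup>2) * (s - fixpt)\<bar> * (q\<^sup>2) ^ n) * \<bar>f (iter (2 * n + 1) s)\<bar>"
      unfolding int_term_def iter_weight_eq using q_pos by (simp add: abs_mult power_mult)
    also have "\<dots> \<le> (\<bar>(1 - q\<^sup>2) * (s - fixpt)\<bar> * (q\<^sup>2) ^ n) * K"
      using K[of n] by (intro mult_left_mono) auto
    finally show ?thesis by (simp add: algebra_simps)
  qed
  ultimately show ?thesis
    by (rule summable_comparison_test')
qed

lemma integral_from_fixpoint_eq:
  assumes "summable (int_term f s)"
  shows "hahn_integral_from_fixpoint q \<omega> s f = suminf (int_term f s)"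
proof (cases "s = fixpt")
  case True
  then show ?thesis
    using unshift_shift[of fixpt] by (simp add: hahn_integral_from_fixpoint_def shift_eq)
next
  case False
  have "fixpt + q * (inverse q * (s - fixpt)) = s"
    using q_pos by (simp flip: mult.assoc)
  then have unshift: "hahn_unshift q \<omega> s = fixpt + inverse q * (s - fixpt)"
    using unshift_shift[of "fixpt + inverse q * (s - fixpt)"] by (simp only: shift_eq add_diff_cancel_left')
  let ?C = "hahn_unshift q \<omega> s - hahn_shift q \<omega> s"
  have C: "?C = (inverse q - q) * (s - fixpt)"
    unfolding unshift shift_eq by (simp add: algebra_simps)
  have "inverse q \<noteq> q"
    using q_pos q_less_1 one_less_inverse[of q] by auto
  then have "?C \<noteq> 0"
    using False C by simp
  have int_term: "int_term f s = (\<lambda>n. ?C * (q ^ (2 * n + 1) * f (iter (2 * n + 1) s)))"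
    unfolding int_term_def iter_weight_eq C
    using q_pos by (auto simp: fun_eq_iff power2_eq_square field_simps)
  \<comment> \<open>Summability passes to the series without prefactor by dividing by
    \<open>?C\<close>; at the fixed point \<open>?C\<close> is zero, hence the separate
    case.\<close>
  then have "summable (\<lambda>n. q ^ (2 * n + 1) * f (iter (2 * n + 1) s))"
    using assms \<open>?C \<noteq> 0\<close> by (simp add: summable_cmult_iff)
  then show ?thesis
    unfolding hahn_integral_from_fixpoint_def int_term by (rule suminf_mult[symmetric])
qed

lemma int_term_iter: "int_term f (iter (2 * k) s) n = int_term f s (n + k)"
proof -
  have "iter m (iter (2 * k) s) = iter (m + 2 * k) s" for m
    by (simp add: funpow_add)
  then show ?thesis
    by (simp add: int_term_def algebra_simps del: funpow.simps)
qed

text \<open>Advancing the endpoint by \<open>2 * k\<close> steps drops the first \<open>k\<close>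
  terms of the series.\<close>

lemma integral_from_fixpoint_iter:
  assumes "summable (int_term f s)"
  shows "hahn_integral_from_fixpoint q \<omega> s f - hahn_integral_from_fixpoint q \<omega> (iter (2 * k) s) f
    = (\<Sum>n<k. int_term f s n)"
proof -
  have shift: "int_term f (iter (2 * k) s) = (\<lambda>n. int_term f s (n + k))"
    using int_term_iter by blast
  then have "summable (int_term f (iter (2 * k) s))"
    using assms by (simp add: summable_iff_shift)
  then show ?thesis
    using suminf_split_initial_segment[OF assms, of k]
    by (simp add: integral_from_fixpoint_eq assms shift)
qed

section \<open>Position of the endpoints relative to the fixed point\<close>

lemma orbit_memE:
  assumes "s \<in> hahn_orbit q \<omega> c"
  obtains "s = fixpt" | n where "s = iter (2 * n + 1) c"
  using assms by (auto simp: hahn_orbit_def)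

text \<open>Two odd iterates of \<open>c\<close> differ by an even number of steps, so one is an
  even iterate of the other. The shift contracts towards \<open>fixpt\<close>, so the order of
  \<open>a\<close> and \<open>b\<close> decides on which side they lie and which of them is farther
  out.\<close>

lemma orbit_points_cases:
  assumes "a \<in> hahn_orbit q \<omega> c" "b \<in> hahn_orbit q \<omega> c" "a < b"
  obtains (right) "fixpt < b" "a = fixpt \<or> (\<exists>k. a = iter (2 * k) b)"
  | (left) "a < fixpt" "b = fixpt \<or> (\<exists>k. b = iter (2 * k) a)"
proof -
  have later: "iter (2 * n + 1) c = iter (2 * (n - m)) (iter (2 * m + 1) c)" if "m \<le> n" for m n
  proof -
    have "2 * n + 1 = 2 * (n - m) + (2 * m + 1)"
      using that by simp
    then show ?thesis
      by (metis comp_apply funpow_add)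
  qed
  show thesis
  proof (rule orbit_memE[OF assms(1)])
    assume "a = fixpt"
    then show thesis using right assms by simp
  next
    fix m assume a: "a = iter (2 * m + 1) c"
    show thesis
    proof (rule orbit_memE[OF assms(2)])
      assume "b = fixpt"
      then show thesis using left assms by simp
    next
      fix n assume b: "b = iter (2 * n + 1) c"
      have pow: "0 < q ^ i" "q ^ i \<le> 1" for i
        using q_pos q_less_1 by (simp_all add: power_le_one)
      show thesis
      proof (cases "m \<le> n")
        case True
        then have ba: "b = iter (2 * (n - m)) a"
          using later a b by blast
        \<comment> \<open>The product equals \<open>a - b\<close>.\<close>
        then have "(1 - q ^ (2 * (n - m))) * (a - fixpt) < 0"
          using assms(3) unfolding iter_eq by (simp add: algebra_simps)
        then have "a < fixpt"
          using pow[of "2 * (n - m)"] by (simp add: mult_less_0_iff)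
        then show thesis using left ba by blast
      next
        case False
        then have ab: "a = iter (2 * (m - n)) b"
          using later[of n m] a b by simp
        then have "0 < (1 - q ^ (2 * (m - n))) * (b - fixpt)"
          using assms(3) unfolding iter_eq by (simp add: algebra_simps)
        then have "fixpt < b"
          using pow[of "2 * (m - n)"] by (simp add: zero_less_mult_iff)
        then show thesis using right ab by blast
      qed
    qed
  qed
qed

section \<open>Convexity estimate and telescoping\<close>

text \<open>
  The factor \<open>\<epsilon>\<close> is \<open>1\<close> for convex and \<open>-1\<close> for concave Lagrangians; the factor \<open>s - fixpt\<close> carries
  the sign of the weights.
\<close>

lemma partial_sums_ge:
  assumes I: "is_interval I" "fixpt \<in> I" "s \<in> I" and "s \<noteq> fixpt"
    and subgradient: "\<forall>t\<in>I. \<forall>u v u1 v1.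
      \<epsilon> * (partial2 L t u v * u1 + partial3 L t u v * v1)
        \<le> \<epsilon> * (L t (u + u1) (v + v1) - L t u v)"
    and EL: "hahn_euler_lagrange q \<omega> I L a b ystar"
    and orbit: "hahn_orbit q \<omega> s \<subseteq> hahn_orbits q \<omega> a b"
    and "y s = ystar s"
  shows "(s - fixpt) * (\<epsilon> * - (hahn_along q \<omega> I (partial3 L) ystar (iter (2 * k + 1) s)
            * (y (iter (2 * k) s) - ystar (iter (2 * k) s))))
    \<le> (s - fixpt) * (\<epsilon> * ((\<Sum>n<k. int_term (hahn_along q \<omega> I L y) s n)
            - (\<Sum>n<k. int_term (hahn_along q \<omega> I L ystar) s n)))"
proof -
  let ?d = "\<lambda>t. y t - ystar t"
  let ?g = "hahn_along q \<omega> I (partial3 L) ystar"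
  let ?G = "\<lambda>n. ?g (iter (2 * n + 1) s) * ?d (iter (2 * n) s)"
  have step: "(s - fixpt) * (\<epsilon> * (?G n - ?G (Suc n)))
      \<le> (s - fixpt) * (\<epsilon> * (int_term (hahn_along q \<omega> I L y) s n
          - int_term (hahn_along q \<omega> I L ystar) s n))" for n
  proof -
    let ?t = "iter (2 * n + 1) s"
    let ?w = "iter (2 * n) s - iter (2 * n + 2) s"
    let ?u = "ystar (hahn_shift q \<omega> ?t)" and ?v = "hahn_sym_deriv q \<omega> I ystar ?t"
    let ?u1 = "?d (hahn_shift q \<omega> ?t)"
      and ?v1 = "hahn_sym_deriv q \<omega> I y ?t - hahn_sym_deriv q \<omega> I ystar ?t"
    have w: "?w = (1 - q\<^sup>2) * q ^ (2 * n) * (s - fixpt)"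
      by (rule iter_weight_eq)
    have "q\<^sup>2 < 1"
      using q_pos q_less_1 by (simp add: power_less_one_iff)
    then have "?w \<noteq> 0"
      using w q_pos assms(4) by simp
    have "0 \<le> (1 - q\<^sup>2) * q ^ (2 * n) * (s - fixpt)\<^sup>2"
      using \<open>q\<^sup>2 < 1\<close> q_pos by simp
    \<comment> \<open>The weight is a positive multiple of \<open>s - fixpt\<close>, so multiplying
      by that factor makes it nonnegative on either side.\<close>
    then have w_sign: "0 \<le> (s - fixpt) * ?w"
      unfolding w by (simp add: power2_eq_square algebra_simps)
    have "?t \<in> hahn_orbits q \<omega> a b"
      using orbit by (auto simp: hahn_orbit_def)
    then have "partial2 L ?t ?u ?v = hahn_sym_deriv q \<omega> I (\<lambda>\<tau>. ?g (hahn_shift q \<omega> \<tau>)) ?t"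
      using EL by (simp add: hahn_euler_lagrange_def hahn_along_def numeral_2_eq_2)
    \<comment> \<open>The neighbours of \<open>?t\<close> have indices \<open>2 * n\<close> and
      \<open>2 * n + 2\<close>; the inner shift in the Euler-Lagrange equation moves them to the odd
      indices where \<open>?g\<close> is sampled.\<close>
    also have "\<dots> = (?g (iter (2 * n + 3) s) - ?g ?t) / - ?w"
      using sym_deriv_iter[OF assms(4), of I _ "2 * n"] by (simp add: numeral_3_eq_3)
    finally have p2: "?w * partial2 L ?t ?u ?v = ?g ?t - ?g (iter (2 * n + 3) s)"
      using \<open>?w \<noteq> 0\<close> by (simp add: field_simps)
    have "?v1 = (?d (iter (2 * n + 2) s) - ?d (iter (2 * n) s)) / - ?w"
      using sym_deriv_diff_iter[OF assms(4), of I y "2 * n" ystar] by simp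
    then have v1: "?w * ?v1 = ?d (iter (2 * n) s) - ?d (iter (2 * n + 2) s)"
      using \<open>?w \<noteq> 0\<close> by (simp add: field_simps)
    \<comment> \<open>Discrete product rule. It fits the linearisation because \<open>?u1\<close> is
      the difference \<open>y - ystar\<close> at index \<open>2 * n + 2\<close>.\<close>
    have "?G n - ?G (Suc n) =
        (?g ?t - ?g (iter (2 * n + 3) s)) * ?u1
          + ?g ?t * (?d (iter (2 * n) s) - ?d (iter (2 * n + 2) s))"
      by (simp add: algebra_simps numeral_3_eq_3)
    also have "\<dots> = ?w * (partial2 L ?t ?u ?v * ?u1 + partial3 L ?t ?u ?v * ?v1)"
      unfolding p2[symmetric] v1[symmetric] by (simp add: hahn_along_def algebra_simps)
    finally have G: "?G n - ?G (Suc n) =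
        ?w * (partial2 L ?t ?u ?v * ?u1 + partial3 L ?t ?u ?v * ?v1)" .
    have "\<epsilon> * (partial2 L ?t ?u ?v * ?u1 + partial3 L ?t ?u ?v * ?v1)
        \<le> \<epsilon> * (L ?t (?u + ?u1) (?v + ?v1) - L ?t ?u ?v)"
      using subgradient iter_mem[OF I] by blast
    from mult_left_mono[OF this w_sign]
    have "(s - fixpt) * (\<epsilon> * (?w * (partial2 L ?t ?u ?v * ?u1 + partial3 L ?t ?u ?v * ?v1)))
        \<le> (s - fixpt) * (\<epsilon> * (?w * (L ?t (?u + ?u1) (?v + ?v1) - L ?t ?u ?v)))"
      by (simp only: ac_simps)
    moreover have "int_term (hahn_along q \<omega> I L y) s n - int_term (hahn_along q \<omega> I L ystar) s n
        = ?w * (L ?t (?u + ?u1) (?v + ?v1) - L ?t ?u ?v)"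
      unfolding int_term_def hahn_along_def by (simp add: right_diff_distrib)
    ultimately show ?thesis
      unfolding G by simp
  qed
  \<comment> \<open>Only the far boundary term survives: \<open>?G 0\<close> contains
    \<open>y s - ystar s\<close>, which is zero.\<close>
  have "(\<Sum>n<k. ?G n - ?G (Suc n)) = - ?G k"
    using sum_lessThan_telescope'[of ?G k] assms(8) by simp
  then have "(s - fixpt) * (\<epsilon> * - ?G k) = (\<Sum>n<k. (s - fixpt) * (\<epsilon> * (?G n - ?G (Suc n))))"
    by (simp flip: sum_distrib_left)
  also have "\<dots> \<le> (\<Sum>n<k. (s - fixpt) * (\<epsilon> * (int_term (hahn_along q \<omega> I L y) s n
          - int_term (hahn_along q \<omega> I L ystar) s n)))"
    by (intro sum_mono step)
  finally show ?thesis
    by (simp flip: sum_distrib_left add: sum_subtractf)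
qed

text \<open>The nearer endpoint \<open>e\<close> is reached after finitely many steps or only in the
  limit. Either way the boundary term of the partial sums disappears because \<open>y\<close> and
  \<open>ystar\<close> agree at \<open>e\<close>.\<close>

lemma integral_difference_nonneg:
  assumes I: "is_interval I" "fixpt \<in> I" "s \<in> I" and s: "s \<noteq> fixpt"
    and subgradient: "\<forall>t\<in>I. \<forall>u v u1 v1.
      \<epsilon> * (partial2 L t u v * u1 + partial3 L t u v * v1)
        \<le> \<epsilon> * (L t (u + u1) (v + v1) - L t u v)"
    and EL: "hahn_euler_lagrange q \<omega> I L a b ystar"
    and orbit: "hahn_orbit q \<omega> s \<subseteq> hahn_orbits q \<omega> a b"
    and ends: "y s = ystar s" "y e = ystar e"
    and e: "e = fixpt \<or> (\<exists>k. e = iter (2 * k) s)"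
    and cont: "continuous (at fixpt within I) y" "continuous (at fixpt within I) ystar"
      "continuous (at fixpt within I) (hahn_along q \<omega> I L y)"
      "continuous (at fixpt within I) (hahn_along q \<omega> I L ystar)"
      "continuous (at fixpt within I) (hahn_along q \<omega> I (partial3 L) ystar)"
  shows "0 \<le> (s - fixpt) * (\<epsilon> *
    ((hahn_integral_from_fixpoint q \<omega> s (hahn_along q \<omega> I L y)
        - hahn_integral_from_fixpoint q \<omega> e (hahn_along q \<omega> I L y))
     - (hahn_integral_from_fixpoint q \<omega> s (hahn_along q \<omega> I L ystar)
        - hahn_integral_from_fixpoint q \<omega> e (hahn_along q \<omega> I L ystar))))"
proof -
  let ?f = "hahn_along q \<omega> I L y" and ?h = "hahn_along q \<omega> I L ystar"
  let ?g = "hahn_along q \<omega> I (partial3 L) ystar"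
  note partial = partial_sums_ge[where \<epsilon> = \<epsilon> and y = y, OF I s subgradient EL orbit ends(1)]
  have summable: "summable (int_term ?f s)" "summable (int_term ?h s)"
    using int_term_summable cont(3,4) I by blast+
  from e show ?thesis
  proof
    assume "e = fixpt"
    have mono: "strict_mono (\<lambda>n::nat. 2 * n)" "strict_mono (\<lambda>n::nat. 2 * n + 1)"
      by (simp_all add: strict_mono_def)
    \<comment> \<open>Continuity at \<open>fixpt\<close> carries the boundary term to a multiple of
      \<open>y fixpt - ystar fixpt\<close>.\<close>
    have "(\<lambda>k. (s - fixpt) * (\<epsilon> *
          - (?g (iter (2 * k + 1) s) * (y (iter (2 * k) s) - ystar (iter (2 * k) s)))))
        \<longlonglongrightarrow> (s - fixpt) * (\<epsilon> * - (?g fixpt * (y fixpt - ystar fixpt)))"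
      by (intro tendsto_intros continuous_along_iter[OF _ I] cont mono)
    then have lower: "(\<lambda>k. (s - fixpt) * (\<epsilon> *
          - (?g (iter (2 * k + 1) s) * (y (iter (2 * k) s) - ystar (iter (2 * k) s))))) \<longlonglongrightarrow> 0"
      using ends(2) \<open>e = fixpt\<close> by simp
    have "(\<lambda>k. (s - fixpt) * (\<epsilon> * ((\<Sum>n<k. int_term ?f s n) - (\<Sum>n<k. int_term ?h s n))))
        \<longlonglongrightarrow> (s - fixpt) * (\<epsilon> * (suminf (int_term ?f s) - suminf (int_term ?h s)))"
      by (intro tendsto_intros summable_LIMSEQ summable)
    from LIMSEQ_le[OF lower this] partial
    have "0 \<le> (s - fixpt) * (\<epsilon> * (suminf (int_term ?f s) - suminf (int_term ?h s)))"
      by blast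
    moreover have "hahn_integral_from_fixpoint q \<omega> fixpt f = 0" for f
      using integral_from_fixpoint_eq[of f fixpt] by simp
    ultimately show ?thesis
      using \<open>e = fixpt\<close> by (simp add: integral_from_fixpoint_eq summable)
  next
    assume "\<exists>k. e = iter (2 * k) s"
    then obtain k where "e = iter (2 * k) s" by blast
    then show ?thesis
      using partial[of k] ends(2) by (simp add: integral_from_fixpoint_iter summable)
  qed
qed

end

section \<open>Global optimality in the convex and concave cases\<close>

theorem theorem7p3p10:
  fixes q \<omega> a b c \<alpha> \<beta> :: real
    and I :: "real set"
    and L :: "real \<Rightarrow> real \<Rightarrow> real \<Rightarrow> real"
    and ystar :: "real \<Rightarrow> real"
  assumes "0 < q" and "q < 1" and "0 \<le> \<omega>"
    and "is_interval I" and "hahn_fixpoint q \<omega> \<in> I"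
    and "a \<in> I" and "b \<in> I" and "a < b"
    and "c \<in> I" and "a \<in> hahn_orbit q \<omega> c" and "b \<in> hahn_orbit q \<omega> c"
    and "\<And>t. t \<in> I \<Longrightarrow> C1_plane (\<lambda>(u, v). L t u v)"
    and "\<And>y. y \<in> hahn_admissible q \<omega> I a b \<alpha> \<beta> \<Longrightarrow>
           continuous (at (hahn_fixpoint q \<omega>) within I) (hahn_along q \<omega> I L y)"
    and "\<And>y. y \<in> hahn_admissible q \<omega> I a b \<alpha> \<beta> \<Longrightarrow>
           hahn_along q \<omega> I (partial2 L) y \<in> hahn_Y1 q \<omega> I a b"
    and "\<And>y. y \<in> hahn_admissible q \<omega> I a b \<alpha> \<beta> \<Longrightarrow>
           hahn_along q \<omega> I (partial3 L) y \<in> hahn_Y1 q \<omega> I a b"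
    and "ystar \<in> hahn_admissible q \<omega> I a b \<alpha> \<beta>"
    and "hahn_euler_lagrange q \<omega> I L a b ystar"
  shows "(jointly_convex I L \<longrightarrow>
            (\<forall>y\<in>hahn_admissible q \<omega> I a b \<alpha> \<beta>.
               hahn_functional q \<omega> I L a b ystar \<le> hahn_functional q \<omega> I L a b y))
       \<and> (jointly_concave I L \<longrightarrow>
            (\<forall>y\<in>hahn_admissible q \<omega> I a b \<alpha> \<beta>.
               hahn_functional q \<omega> I L a b ystar \<ge> hahn_functional q \<omega> I L a b y))"
proof -
  interpret hahn_calculus q \<omega>
    using assms(1,2) by unfold_locales
  let ?A = "hahn_admissible q \<omega> I a b \<alpha> \<beta>"
  have Y1_cont: "continuous (at fixpt within I) f" if "f \<in> hahn_Y1 q \<omega> I a b" for f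
    using that by (simp add: hahn_Y1_def)
  have comparison:
    "\<epsilon> * hahn_functional q \<omega> I L a b ystar \<le> \<epsilon> * hahn_functional q \<omega> I L a b y"
    if y: "y \<in> ?A" and subgradient: "\<forall>t\<in>I. \<forall>u v u1 v1.
      \<epsilon> * (partial2 L t u v * u1 + partial3 L t u v * v1)
        \<le> \<epsilon> * (L t (u + u1) (v + v1) - L t u v)" for \<epsilon> y
  proof -
    have ends: "y a = ystar a" "y b = ystar b"
      using y assms(16) by (simp_all add: hahn_admissible_def)
    have cont: "continuous (at fixpt within I) y" "continuous (at fixpt within I) ystar"
      using y assms(16) by (auto intro: Y1_cont simp: hahn_admissible_def)
    note nonneg = integral_difference_nonneg[where \<epsilon> = \<epsilon> and y = y,
        OF assms(4,5) _ _ subgradient assms(17) _ _ _ _ cont assms(13)[OF y] assms(13)[OF assms(16)]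
          Y1_cont[OF assms(15)[OF assms(16)]]]
    have orbits: "hahn_orbit q \<omega> a \<subseteq> hahn_orbits q \<omega> a b" "hahn_orbit q \<omega> b \<subseteq> hahn_orbits q \<omega> a b"
      by (auto simp: hahn_orbits_def)
    from assms(10,11,8) show ?thesis
    proof (cases rule: orbit_points_cases)
      case right
      then have "0 \<le> \<epsilon> * ((hahn_integral_from_fixpoint q \<omega> b (hahn_along q \<omega> I L y)
          - hahn_integral_from_fixpoint q \<omega> a (hahn_along q \<omega> I L y))
        - (hahn_integral_from_fixpoint q \<omega> b (hahn_along q \<omega> I L ystar)
          - hahn_integral_from_fixpoint q \<omega> a (hahn_along q \<omega> I L ystar)))"
        using nonneg[OF assms(7) _ orbits(2) ends(2,1)] by (simp add: zero_le_mult_iff)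
      then show ?thesis
        by (simp add: hahn_functional_def hahn_integral_def algebra_simps)
    next
      case left
      \<comment> \<open>Here \<open>a\<close> is the farther endpoint: the negative factor
        \<open>a - fixpt\<close> reverses the inequality, and exchanging the limits of integration
        reverses it back.\<close>
      then have "\<epsilon> * ((hahn_integral_from_fixpoint q \<omega> a (hahn_along q \<omega> I L y)
          - hahn_integral_from_fixpoint q \<omega> b (hahn_along q \<omega> I L y))
        - (hahn_integral_from_fixpoint q \<omega> a (hahn_along q \<omega> I L ystar)
          - hahn_integral_from_fixpoint q \<omega> b (hahn_along q \<omega> I L ystar))) \<le> 0"
        using nonneg[OF assms(6) _ orbits(1) ends(1,2)] by (simp add: zero_le_mult_iff)
      then show ?thesis
        by (simp add: hahn_functional_def hahn_integral_def algebra_simps)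
    qed
  qed
  have "hahn_functional q \<omega> I L a b ystar \<le> hahn_functional q \<omega> I L a b y"
    if "jointly_convex I L" "y \<in> ?A" for y
    using comparison[of y 1] that by (simp add: jointly_convex_def)
  moreover have "hahn_functional q \<omega> I L a b y \<le> hahn_functional q \<omega> I L a b ystar"
    if "jointly_concave I L" "y \<in> ?A" for y
    using comparison[of y "-1"] that
    unfolding jointly_concave_def mult_minus1 neg_le_iff_le by blast
  ultimately show ?thesis by blast
qed

end
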